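(* Let $a,b,d\in\mathbb{Z}$ with $b\ge 1$ and $\gcd(a,b)=1$. Let $\ell$ be an odd prime divisor of $a+db$ and let $r$ be an integer with $0\le r<\ell$. Suppose that $d=3$, $\ell\equiv 5$ or $11\pmod{12}$, and $2r+1\equiv 0\pmod{\ell}$. Then for all integers $n\ge 0$, $$p_{[1,3;-a/b]}(\ell n+r)\equiv 0\pmod{\ell}.$$
   Context: For a rational number $t$ and an integer $m>1$, the rational numbers $p_{[1,m;t]}(n)$, $n\ge 0$, are defined by the formal power series identity $\sum_{n\ge 0}p_{[1,m;t]}(n)q^n=\prod_{j\ge 1}\big((1-q^j)(1-q^{mj})\big)^t$, where each power is the binomial series with constant term $1$. For a prime $\ell$ not dividing the denominator of $t$, a congruence $p_{[1,m;t]}(N)\equiv 0\pmod{\ell^k}$ means that the numerator of $p_{[1,m;t]}(N)$, written as a reduced fraction, is divisible by $\ell^k$ (the denominator is then coprime to $\ell$). *)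

theory Defs
  imports "HOL-Analysis.Infinite_Products" "HOL-Computational_Algebra.Formal_Power_Series"
    "HOL-Computational_Algebra.Primes"
begin

text \<open>The binomial series \<open>f\<^sup>t = \<Sum>k. (t choose k) (f - 1)\<^sup>k\<close>. It is meaningful only if \<open>f\<close> has
  constant term \<open>1\<close>, since formal composition requires an inner series without constant term.\<close>

definition fps_rpow :: "'a::field_char_0 fps \<Rightarrow> 'a \<Rightarrow> 'a fps"
  where "fps_rpow f t = fps_binomial t oo (f - 1)"

text \<open>The infinite product is the limit of the partial products in the \<open>X\<close>-adic topology on
  formal power series; its index starts at \<open>0\<close>, hence the exponent \<open>Suc j\<close>.\<close>

definition p_gf :: "nat \<Rightarrow> rat \<Rightarrow> rat fps"
  where "p_gf m t =
    (\<Prod>j. fps_rpow ((1 - fps_X ^ Suc j) * (1 - fps_X ^ (m * Suc j))) t)"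

definition p_coeff :: "nat \<Rightarrow> rat \<Rightarrow> nat \<Rightarrow> rat"
  where "p_coeff m t n = fps_nth (p_gf m t) n"

text \<open>\<open>quotient_of\<close> returns the reduced fraction, so this is divisibility of the numerator.\<close>

definition rat_cong_0 :: "rat \<Rightarrow> int \<Rightarrow> bool"
  where "rat_cong_0 x M \<longleftrightarrow> M dvd fst (quotient_of x)"

lemma fps_rpow_of_nat:
  fixes f :: "'a::field_char_0 fps"
  assumes "fps_nth f 0 = 1"
  shows "fps_rpow f (of_nat k) = f ^ k"
proof -
  have z: "fps_nth (f - 1) 0 = 0"
    using assms by simp
  have "fps_rpow f (of_nat k) = (1 + fps_X) ^ k oo (f - 1)"
    by (simp add: fps_rpow_def fps_binomial_of_nat)
  also have "\<dots> = ((1 + fps_X) oo (f - 1)) ^ k"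
    by (rule fps_compose_power[OF z, symmetric])
  also have "(1 + fps_X) oo (f - 1) = f"
    by (simp only: fps_compose_add_distrib fps_compose_1 fps_X_fps_compose_startby0[OF z]) simp
  finally show ?thesis .
qed

lemma fps_rpow_nth_0 [simp]: "fps_nth (fps_rpow f t) 0 = 1"
  by (simp add: fps_rpow_def fps_compose_nth)

lemma fps_rpow_nth_eq_0:
  assumes "f - 1 = fps_X ^ s * h" and "0 < n" and "n < s"
  shows "fps_nth (fps_rpow f t) n = 0"
proof -
  have "fps_nth ((f - 1) ^ i) n = 0" for i
  proof (cases "i = 0")
    case False
    then have "n < s * i"
      using assms(3) by (metis One_nat_def Suc_leI le_trans linorder_not_le mult.right_neutral
          mult_le_mono2 neq0_conv)
    then show ?thesis
      by (simp add: assms(1) power_mult_distrib fps_X_power_mult_nth flip: power_mult)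
  qed (use assms(2) in simp)
  then show ?thesis
    by (simp add: fps_rpow_def fps_compose_nth)
qed

theorem p_gf_has_prod:
  assumes "m > 0"
  shows "(\<lambda>j. fps_rpow ((1 - fps_X ^ Suc j) * (1 - fps_X ^ (m * Suc j))) t) has_prod p_gf m t"
proof -
  define f where
    "f = (\<lambda>j. fps_rpow ((1 - fps_X ^ Suc j) * (1 - fps_X ^ (m * Suc j)) :: rat fps) t)"
  have f0: "fps_nth (f j) 0 = 1" for j
    by (simp add: f_def)
  have fn: "fps_nth (f j) n = 0" if "0 < n" "n \<le> j" for j n
  proof -
    obtain k where k: "m = Suc k"
      using assms by (cases m) auto
    have ident: "(1 - x) * (1 - x * y) - 1 = x * (- 1 - y * (1 - x))" for x y :: "rat fps"
      by (simp add: algebra_simps)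
    have "(1 - fps_X ^ Suc j) * (1 - fps_X ^ (m * Suc j)) - 1 =
        fps_X ^ Suc j * (- 1 - fps_X ^ (k * Suc j) * (1 - fps_X ^ Suc j) :: rat fps)"
      unfolding k mult_Suc power_add by (rule ident)
    then show ?thesis
      unfolding f_def by (rule fps_rpow_nth_eq_0) (use that in auto)
  qed
  define P where "P = (\<lambda>N. \<Prod>i\<le>N. f i)"
  have step: "fps_nth (P (Suc N)) n = fps_nth (P N) n" if "n \<le> Suc N" for N n
  proof -
    have "fps_nth (P (Suc N)) n = (\<Sum>i=0..n. fps_nth (f (Suc N)) i * fps_nth (P N) (n - i))"
      by (simp add: P_def fps_mult_nth mult.commute[of _ "f (Suc N)"])
    also have "\<dots> = (\<Sum>i\<in>{0}. fps_nth (f (Suc N)) i * fps_nth (P N) (n - i))"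
      by (rule sum.mono_neutral_right) (use fn that in auto)
    finally show ?thesis
      by (simp add: f0)
  qed
  have stab: "fps_nth (P N) n = fps_nth (P n) n" if "n \<le> N" for N n
    using that by (induction N rule: dec_induct) (auto simp: step)
  define L where "L = Abs_fps (\<lambda>n. fps_nth (P n) n)"
  have "P \<longlonglongrightarrow> L"
  proof (rule tendsto_fpsI)
    show "\<forall>\<^sub>F N in sequentially. fps_nth (P N) n = fps_nth L n" for n
      using eventually_ge_at_top[of n] by eventually_elim (unfold L_def fps_nth_Abs_fps, rule stab)
  qed
  moreover have "L \<noteq> 0"
  proof
    assume "L = 0"
    then have "fps_nth L 0 = 0"
      by simp
    then show False
      by (simp add: L_def P_def f0)
  qed
  ultimately have "f has_prod L"
    by (simp add: has_prod_def raw_has_prod_def P_def)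
  then have "f has_prod p_gf m t"
    using has_prod_unique[of f L] by (simp add: p_gf_def f_def)
  then show ?thesis
    by (simp add: f_def)
qed

end

theory Submission
  imports Defs "HOL-Number_Theory.Residues"
begin

text \<open>Put \<open>t = -a/b\<close>. Since \<open>\<ell>\<close> divides \<open>a + 3b\<close> but not \<open>b\<close>, we have \<open>t = 3 + \<ell>s\<close> with \<open>s\<close>
  integral at \<open>\<ell>\<close>, so the generating function is \<open>A Q\<^bsup>\<ell>\<^esup>\<close>, where
  \<open>A = \<Prod>\<^sub>j (1 - X\<^sup>j)\<^sup>3 (1 - X\<^bsup>3j\<^esup>)\<^sup>3\<close> and \<open>Q\<close> is integral at \<open>\<ell>\<close>. Modulo \<open>\<ell>\<close>, only exponents
  divisible by \<open>\<ell>\<close> survive in \<open>Q\<^bsup>\<ell>\<^esup>\<close>, so it is enough that the coefficients of \<open>A\<close> at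
  \<open>k \<equiv> r\<close> vanish modulo \<open>\<ell>\<close>. By Jacobi's identity
  \<open>\<Prod>\<^sub>j (1 - q\<^sup>j)\<^sup>3 = \<Sum>\<^sub>j (-1)\<^sup>j (2j+1) q\<^bsup>j(j+1)/2\<^esup>\<close>, such a coefficient is a sum of terms
  \<open>\<plusminus>(2i+1)(2j+1)\<close> with \<open>(2i+1)\<^sup>2 + 3(2j+1)\<^sup>2 = 4(2k+1) \<equiv> 0\<close>; as \<open>-3\<close> is not a square modulo
  \<open>\<ell>\<close>, each of them is divisible by \<open>\<ell>\<close>.

  Jacobi's identity is used modulo \<open>q\<^bsup>n+1\<^esup>\<close> and comes from the finite form
  \<open>\<Sum>\<^sub>j (-1)\<^sup>j (2j+1) q\<^bsup>j(j+1)/2\<^esup> [2n+1, n+1+j]\<^sub>q = \<Prod>\<^bsub>i\<le>n\<^esub> (1 - q\<^sup>i)\<^sup>2\<close>, which needs no division.\<close>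

section \<open>Gaussian binomial coefficients\<close>

text \<open>The Pascal recursion makes sense in every commutative ring, where a quotient of
  q-factorials need not exist.\<close>

fun gauss_binomial :: "'a::comm_ring_1 \<Rightarrow> nat \<Rightarrow> nat \<Rightarrow> 'a" where
  "gauss_binomial q n 0 = 1"
| "gauss_binomial q 0 (Suc k) = 0"
| "gauss_binomial q (Suc n) (Suc k) =
     gauss_binomial q n k + q ^ Suc k * gauss_binomial q n (Suc k)"

declare gauss_binomial.simps(3) [simp del]

lemma gauss_binomial_eq_0: "n < k \<Longrightarrow> gauss_binomial q n k = 0"
  by (induction q n k rule: gauss_binomial.induct) (simp_all add: gauss_binomial.simps(3))

lemma gauss_binomial_refl [simp]: "gauss_binomial q n n = 1"
  by (induction n) (simp_all add: gauss_binomial_eq_0 gauss_binomial.simps(3))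

text \<open>Expand by the first Pascal rule, apply the induction hypothesis to both terms and
  regroup. Truncation in \<open>n - k\<close> is harmless, as \<open>gauss_binomial q n k\<close>
  vanishes for \<open>k > n\<close>.\<close>

lemma gauss_binomial_Suc_Suc':
  "gauss_binomial q (Suc n) (Suc k) =
     q ^ (n - k) * gauss_binomial q n k + gauss_binomial q n (Suc k)"
proof (induction n arbitrary: k)
  case 0
  then show ?case by (cases k) (simp_all add: gauss_binomial.simps(3))
next
  case (Suc n)
  show ?case
  proof (cases k)
    case 0
    then show ?thesis
      using Suc.IH[of 0] by (simp add: gauss_binomial.simps(3) algebra_simps)
  next
    case (Suc i)
    let ?g = "gauss_binomial q"
    have pow: "q ^ Suc k * (q ^ (n - k) * ?g n k) = q ^ (n - i) * (q ^ k * ?g n k)"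
    proof (cases "k \<le> n")
      case True
      then have "Suc k + (n - k) = n - i + k" using Suc by simp
      then show ?thesis by (simp only: mult.assoc[symmetric] power_add[symmetric])
    qed (simp add: gauss_binomial_eq_0)
    have "?g (Suc (Suc n)) (Suc k) =
        ?g (Suc n) k + q ^ Suc k * ?g (Suc n) (Suc k)"
      by (rule gauss_binomial.simps)
    also have "\<dots> = q ^ (n - i) * ?g n i + ?g n k +
        (q ^ Suc k * (q ^ (n - k) * ?g n k) + q ^ Suc k * ?g n (Suc k))"
      using Suc.IH[of i] Suc.IH[of k] Suc by (simp only: distrib_left)
    also have "\<dots> = q ^ (n - i) * (?g n i + q ^ k * ?g n k) + (?g n k + q ^ Suc k * ?g n (Suc k))"
      unfolding pow by (simp only: algebra_simps)
    also have "?g n i + q ^ k * ?g n k = ?g (Suc n) k"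
      unfolding Suc by (rule gauss_binomial.simps [symmetric])
    also have "?g n k + q ^ Suc k * ?g n (Suc k) = ?g (Suc n) (Suc k)"
      by (rule gauss_binomial.simps [symmetric])
    finally show ?thesis
      using Suc by simp
  qed
qed

definition q_fact :: "'a::comm_ring_1 \<Rightarrow> nat \<Rightarrow> 'a"
  where "q_fact q n = (\<Prod>i=1..n. 1 - q ^ i)"

lemma q_fact_0 [simp]: "q_fact q 0 = 1"
  by (simp add: q_fact_def)

lemma q_fact_Suc: "q_fact q (Suc n) = q_fact q n * (1 - q ^ Suc n)"
  by (simp add: q_fact_def)

text \<open>Induction on \<open>k + m\<close> by the first Pascal rule and
  \<open>1 - q^(k+m) = (1 - q^k) + q^k * (1 - q^m)\<close>.\<close>

lemma q_fact_mult_gauss_binomial: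
  "q_fact q k * q_fact q m * gauss_binomial q (k + m) k = q_fact q (k + m)"
proof (induction "k + m" arbitrary: k m)
  case 0
  then show ?case by simp
next
  case (Suc n)
  consider "k = 0" | "m = 0" | k' m' where "k = Suc k'" "m = Suc m'"
    by (metis not0_implies_Suc)
  then show ?case
  proof cases
    case 3
    have 1: "q_fact q k' * q_fact q m * gauss_binomial q n k' = q_fact q n"
      and 2: "q_fact q k * q_fact q m' * gauss_binomial q n k = q_fact q n"
      using Suc.hyps(1)[of k' m] Suc.hyps(1)[of k m'] Suc.hyps(2) 3 by auto
    have "q_fact q k * q_fact q m * gauss_binomial q (k + m) k =
        (1 - q ^ k) * (q_fact q k' * q_fact q m * gauss_binomial q n k') +
        q ^ k * (1 - q ^ m) * (q_fact q k * q_fact q m' * gauss_binomial q n k)"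
      unfolding Suc.hyps(2)[symmetric] unfolding 3 gauss_binomial.simps(3) q_fact_Suc
      by (simp add: algebra_simps)
    also have "\<dots> = (1 - q ^ (k + m)) * q_fact q n"
      unfolding 1 2 by (simp add: algebra_simps power_add)
    finally show ?thesis
      unfolding Suc.hyps(2)[symmetric] q_fact_Suc by (simp add: mult.commute)
  qed simp_all
qed

text \<open>In a general ring q-factorials cannot be cancelled, so the induction expands the two
  sides by different Pascal rules.\<close>

lemma gauss_binomial_symmetric: "gauss_binomial q (k + m) k = gauss_binomial q (k + m) m"
proof (induction "k + m" arbitrary: k m)
  case 0
  then show ?case by simp
next
  case (Suc n)
  consider "k = 0" | "m = 0" | k' m' where "k = Suc k'" "m = Suc m'"
    by (metis not0_implies_Suc)
  then show ?case
  proof cases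
    case 3
    have "gauss_binomial q (k + m) k =
        q ^ (n - k') * gauss_binomial q n k' + gauss_binomial q n k"
      using gauss_binomial_Suc_Suc'[of q n k'] Suc.hyps(2) 3 by simp
    also have "gauss_binomial q n k' = gauss_binomial q n m"
      using Suc.hyps(1)[of k' m] Suc.hyps(2) 3 by simp
    also have "gauss_binomial q n k = gauss_binomial q n m'"
      using Suc.hyps(1)[of k m'] Suc.hyps(2) 3 by simp
    also have "n - k' = m"
      using Suc.hyps(2) 3 by simp
    finally show ?thesis
      using gauss_binomial.simps(3)[of q n m'] Suc.hyps(2) 3 by (simp add: add.commute)
  qed simp_all
qed

section \<open>Jacobi's identity in finite form\<close>

lemma triangular_Suc: "Suc j * (Suc j + 1) div 2 = j * (j + 1) div 2 + Suc j"
  by (simp add: algebra_simps)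

text \<open>Summation by parts: the weights \<open>w j = (-1)^j * (2*j+1)\<close> satisfy
  \<open>w (j-1) + w (j+1) = -2 * w j\<close>, and the last summand is the boundary term at
  \<open>m\<close>. At the lower end \<open>h (0 - 1) = h 0\<close> fits because the formula gives
  weight 1 at both -1 and 0.\<close>

lemma jacobi_weight_sum:
  fixes h :: "nat \<Rightarrow> 'a::comm_ring_1"
  shows "(\<Sum>j\<le>m. (-1) ^ j * of_nat (2 * j + 1) * (h (j - 1) + h (Suc j))) =
    - 2 * (\<Sum>j\<le>m. (-1) ^ j * of_nat (2 * j + 1) * h j) +
    (-1) ^ m * (of_nat (2 * m + 1) * h (Suc m) + of_nat (2 * m + 3) * h m)"
  by (induction m) (simp_all add: algebra_simps)

text \<open>The summands \<open>h\<^sub>n(j)\<close> without their weights satisfy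
  \<open>h\<^bsub>n+1\<^esub>(j) = (1 + q\<^bsup>2n+2\<^esup>) h\<^sub>n(j) + q\<^bsup>n+1\<^esup> (h\<^sub>n(j-1) + h\<^sub>n(j+1))\<close>, where \<open>h\<^sub>n(-1) = h\<^sub>n(0)\<close> agrees
  with truncated subtraction. The weights are linear up to sign, so summation turns the
  second bracket into \<open>-2\<close> times the sum, and \<open>1 + q\<^bsup>2n+2\<^esup> - 2q\<^bsup>n+1\<^esup> = (1 - q\<^bsup>n+1\<^esup>)\<^sup>2\<close>.\<close>

lemma finite_jacobi_identity:
  "(\<Sum>j\<le>n. (-1) ^ j * of_nat (2 * j + 1) *
     (q ^ (j * (j + 1) div 2) * gauss_binomial q (2 * n + 1) (n + 1 + j))) = q_fact q n ^ 2"
proof (induction n)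
  case 0
  then show ?case by (simp add: gauss_binomial.simps(3))
next
  case (Suc n)
  define w where "w j = (-1) ^ j * (of_nat (2 * j + 1) :: 'a)" for j
  define h where "h n j = q ^ (j * (j + 1) div 2) * gauss_binomial q (2 * n + 1) (n + 1 + j)" for n j
  have h0: "h n j = 0" if "j > n" for j
    using that by (simp add: h_def gauss_binomial_eq_0)
  have rec: "h (Suc n) j = (1 + q ^ (2 * n + 2)) * h n j + q ^ (n + 1) * (h n (j - 1) + h n (Suc j))"
    if "j \<le> Suc n" for j
  proof -
    let ?g = "gauss_binomial q (2 * n + 1)"
    let ?t = "j * (j + 1) div 2"
    \<comment> \<open>The first Pascal rule once, then the second on both resulting terms.\<close>
    have pascal: "gauss_binomial q (2 * Suc n + 1) (Suc n + 1 + j) =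
        q ^ (n + 1 - j) * ?g (n + j) + ?g (n + 1 + j) +
        q ^ (n + 2 + j) * (q ^ (n - j) * ?g (n + 1 + j) + ?g (n + 2 + j))"
    proof -
      have "gauss_binomial q (2 * Suc n + 1) (Suc n + 1 + j) =
        gauss_binomial q (Suc (2 * n + 1)) (Suc (n + j)) +
        q ^ (n + 2 + j) * gauss_binomial q (Suc (2 * n + 1)) (Suc (n + 1 + j))"
        using gauss_binomial.simps(3)[of q "2 * n + 2" "n + 1 + j"] by simp
      then show ?thesis
        unfolding gauss_binomial_Suc_Suc' by (simp add: algebra_simps)
    qed
    have mid: "q ^ (n + 2 + j) * (q ^ (n - j) * ?g (n + 1 + j)) = q ^ (2 * n + 2) * ?g (n + 1 + j)"
    proof (cases "j \<le> n")
      case True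
      then have "n + 2 + j + (n - j) = 2 * n + 2" by simp
      then show ?thesis by (simp only: mult.assoc[symmetric] power_add[symmetric])
    qed (simp add: gauss_binomial_eq_0)
    have low: "q ^ ?t * q ^ (n + 1 - j) * ?g (n + j) = q ^ (n + 1) * h n (j - 1)"
    proof (cases j)
      \<comment> \<open>Truncation turns \<open>j - 1\<close> into 0; symmetry of row
        \<open>2 * n + 1\<close> about its two middle entries makes this correct.\<close>
      case 0
      then show ?thesis
        by (simp add: h_def gauss_binomial_symmetric[of q n "n + 1", simplified] mult_2)
    next
      case (Suc i)
      then have "?t + (n + 1 - j) = n + 1 + (j - 1) * (j - 1 + 1) div 2" "n + j = n + 1 + (j - 1)"
        using that triangular_Suc[of i] by simp_all
      then show ?thesis
        by (simp only: h_def mult.assoc[symmetric] power_add[symmetric])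
    qed
    have high: "q ^ ?t * q ^ (n + 2 + j) * ?g (n + 2 + j) = q ^ (n + 1) * h n (Suc j)"
    proof -
      have "?t + (n + 2 + j) = n + 1 + Suc j * (Suc j + 1) div 2"
        unfolding triangular_Suc by simp
      then show ?thesis
        by (simp only: h_def mult.assoc[symmetric] power_add[symmetric]) simp
    qed
    have "h (Suc n) j = q ^ ?t * q ^ (n + 1 - j) * ?g (n + j) + q ^ ?t * ?g (n + 1 + j) +
       q ^ ?t * (q ^ (n + 2 + j) * (q ^ (n - j) * ?g (n + 1 + j))) +
       q ^ ?t * q ^ (n + 2 + j) * ?g (n + 2 + j)"
      unfolding h_def pascal by (simp add: algebra_simps)
    also have "\<dots> = (1 + q ^ (2 * n + 2)) * h n j + q ^ (n + 1) * (h n (j - 1) + h n (Suc j))"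
      unfolding mid low high by (simp add: h_def algebra_simps)
    finally show ?thesis .
  qed
  have "(\<Sum>j\<le>Suc n. w j * h (Suc n) j) =
      (\<Sum>j\<le>Suc n. (1 + q ^ (2 * n + 2)) * (w j * h n j) +
         q ^ (n + 1) * (w j * (h n (j - 1) + h n (Suc j))))"
    by (intro sum.cong refl) (simp add: rec algebra_simps)
  also have "\<dots> = (1 + q ^ (2 * n + 2)) * (\<Sum>j\<le>Suc n. w j * h n j) +
      q ^ (n + 1) * (\<Sum>j\<le>Suc n. w j * (h n (j - 1) + h n (Suc j)))"
    by (simp only: sum.distrib sum_distrib_left)
  \<comment> \<open>The boundary term at \<open>m = Suc n\<close> vanishes, since \<open>h n\<close>
    is zero beyond \<open>n\<close>.\<close>
  also have "(\<Sum>j\<le>Suc n. w j * (h n (j - 1) + h n (Suc j))) = - 2 * (\<Sum>j\<le>Suc n. w j * h n j)"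
    unfolding w_def jacobi_weight_sum by (simp add: h0)
  also have "(\<Sum>j\<le>Suc n. w j * h n j) = q_fact q n ^ 2"
    using Suc.IH by (simp only: sum.atMost_Suc h0[OF lessI]) (simp add: w_def h_def)
  also have "(1 + q ^ (2 * n + 2)) * q_fact q n ^ 2 + q ^ (n + 1) * (- 2 * q_fact q n ^ 2) =
      q_fact q (Suc n) ^ 2"
  proof -
    have "2 * n + 2 = Suc n * 2" by simp
    then have "q ^ (2 * n + 2) = (q ^ Suc n) ^ 2" by (simp only: power_mult)
    then show ?thesis
      unfolding q_fact_Suc by (simp only:) (simp add: algebra_simps power2_eq_square)
  qed
  finally show ?case by (simp only: w_def h_def)
qed

section \<open>Jacobi's identity modulo a power of q\<close>

text \<open>Every factor beyond the first \<open>k\<close> is 1 modulo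
  \<open>q ^ Suc k\<close>.\<close>

lemma q_fact_cong:
  assumes "k \<le> m"
  shows "q ^ Suc k dvd q_fact q m - q_fact q k"
  using assms
proof (induction m rule: dec_induct)
  case (step m)
  have "q_fact q (Suc m) - q_fact q k = (q_fact q m - q_fact q k) - q ^ Suc m * q_fact q m"
    by (simp add: q_fact_Suc algebra_simps)
  moreover have "q ^ Suc k dvd q ^ Suc m * q_fact q m"
    using step.hyps by (intro dvd_mult2 le_imp_power_dvd) simp
  ultimately show ?case using step.IH by (metis dvd_diff)
qed simp

lemma q_fact_nth_0:
  fixes q :: "'a::comm_ring_1 fps"
  assumes "fps_nth q 0 = 0"
  shows "fps_nth (q_fact q n) 0 = 1"
  by (induction n) (simp_all add: q_fact_Suc assms)

text \<open>The q-factorials of \<open>n - j\<close>, \<open>n\<close>, \<open>n + 1 + j\<close> and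
  \<open>2 * n + 1\<close> agree modulo \<open>q ^ Suc (n - j)\<close>. The product formula then
  gives the claim multiplied by \<open>E\<close>, a unit because its constant term is 1.\<close>

lemma q_fact_mult_gauss_binomial_cong_1:
  fixes q :: "'a::field fps"
  assumes "fps_nth q 0 = 0" and "j \<le> n"
  shows "q ^ Suc (n - j) dvd q_fact q n * gauss_binomial q (2 * n + 1) (n + 1 + j) - 1"
proof -
  define E F H T x where "E = q_fact q (n - j)" and "F = q_fact q (n + 1 + j)"
    and "H = q_fact q n" and "T = q_fact q (2 * n + 1)"
    and "x = gauss_binomial q (2 * n + 1) (n + 1 + j)"
  have "F * E * x = T"
    using q_fact_mult_gauss_binomial[of q "n + 1 + j" "n - j"] assms(2)
    by (simp add: E_def F_def T_def x_def mult_2)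
  then have "E * (H * x - 1) = (H - E) * (E * x) - (F - E) * (E * x) + (T - E)"
    by (simp add: algebra_simps)
  moreover have "q ^ Suc (n - j) dvd H - E" "q ^ Suc (n - j) dvd F - E" "q ^ Suc (n - j) dvd T - E"
    unfolding E_def F_def H_def T_def by (intro q_fact_cong; simp)+
  ultimately have "q ^ Suc (n - j) dvd E * (H * x - 1)"
    by (metis dvd_add dvd_diff dvd_mult2)
  moreover have "is_unit E"
    by (simp add: E_def q_fact_nth_0 assms(1))
  ultimately show ?thesis
    unfolding H_def x_def by (simp add: dvd_mult_unit_iff')
qed

text \<open>Multiply the finite identity by \<open>q_fact q n\<close>. Replacing
  \<open>q_fact q n\<close> times the Gaussian binomial by 1 loses \<open>j\<close> orders of
  precision, which the factor \<open>q ^ (j * (j + 1) div 2)\<close> restores.\<close>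

lemma jacobi_cube_cong:
  fixes q :: "'a::field fps"
  assumes "fps_nth q 0 = 0"
  shows "q ^ Suc n dvd q_fact q n ^ 3 -
    (\<Sum>j\<le>n. (-1) ^ j * of_nat (2 * j + 1) * q ^ (j * (j + 1) div 2))"
proof -
  let ?g = "\<lambda>j. gauss_binomial q (2 * n + 1) (n + 1 + j)"
  have cube: "q_fact q n ^ 3 = q_fact q n * q_fact q n ^ 2"
    by (simp add: power3_eq_cube power2_eq_square)
  have eq: "q_fact q n ^ 3 - (\<Sum>j\<le>n. (-1) ^ j * of_nat (2 * j + 1) * q ^ (j * (j + 1) div 2)) =
      (\<Sum>j\<le>n. (-1) ^ j * of_nat (2 * j + 1) *
         (q ^ (j * (j + 1) div 2) * (q_fact q n * ?g j - 1)))"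
    unfolding cube finite_jacobi_identity[symmetric] sum_distrib_left sum_subtractf[symmetric]
    by (intro sum.cong refl) (simp add: algebra_simps)
  show ?thesis
    unfolding eq
  proof (rule dvd_sum)
    fix j assume "j \<in> {..n}"
    then have j: "j \<le> n" by simp
    have "j \<le> j * (j + 1) div 2"
      by (induction j) (simp_all add: triangular_Suc)
    then have "q ^ Suc n dvd q ^ (j * (j + 1) div 2 + Suc (n - j))"
      using j by (intro le_imp_power_dvd) simp
    also have "\<dots> dvd q ^ (j * (j + 1) div 2) * (q_fact q n * ?g j - 1)"
      unfolding power_add
      by (intro mult_dvd_mono dvd_refl q_fact_mult_gauss_binomial_cong_1 assms j)
    finally show "q ^ Suc n dvd (-1) ^ j * of_nat (2 * j + 1) *
        (q ^ (j * (j + 1) div 2) * (q_fact q n * ?g j - 1))"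
      by (rule dvd_mult)
  qed
qed

section \<open>Numbers and power series integral at a prime\<close>

text \<open>The localization of the integers at \<open>p\<close>. Fractions need not be reduced, so
  sums and products can be handled by the usual formulas.\<close>

definition integral_at :: "nat \<Rightarrow> rat \<Rightarrow> bool"
  where "integral_at p x \<longleftrightarrow> (\<exists>u v. x = of_int u / of_int v \<and> \<not> int p dvd v)"

lemma integral_atI: "\<not> int p dvd v \<Longrightarrow> integral_at p (of_int u / of_int v)"
  by (auto simp: integral_at_def)

lemma integral_at_of_int: "prime p \<Longrightarrow> integral_at p (of_int u)"
  using integral_atI[of p 1 u] by (cases "p = 1") auto

lemma integral_at_0 [simp]: "prime p \<Longrightarrow> integral_at p 0"
  using integral_at_of_int[of p 0] by simp

lemma integral_at_1 [simp]: "prime p \<Longrightarrow> integral_at p 1"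
  using integral_at_of_int[of p 1] by simp

lemma integral_at_add:
  assumes "prime p" "integral_at p x" "integral_at p y"
  shows "integral_at p (x + y)"
proof -
  obtain u v u' v' where x: "x = of_int u / of_int v" "\<not> int p dvd v"
    and y: "y = of_int u' / of_int v'" "\<not> int p dvd v'"
    using assms unfolding integral_at_def by blast
  have "v \<noteq> 0" "v' \<noteq> 0" using x y by auto
  then have "x + y = of_int (u * v' + u' * v) / of_int (v * v')"
    by (simp add: x y field_simps)
  moreover have "\<not> int p dvd v * v'"
    using x y assms(1) by (simp add: prime_dvd_mult_iff)
  ultimately show ?thesis
    by (simp only: integral_atI not_False_eq_True)
qed

lemma integral_at_mult:
  assumes "prime p" "integral_at p x" "integral_at p y"
  shows "integral_at p (x * y)"
proof -
  obtain u v u' v' where x: "x = of_int u / of_int v" "\<not> int p dvd v"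
    and y: "y = of_int u' / of_int v'" "\<not> int p dvd v'"
    using assms unfolding integral_at_def by blast
  have "x * y = of_int (u * u') / of_int (v * v')"
    by (simp add: x y)
  moreover have "\<not> int p dvd v * v'"
    using x y assms(1) by (simp add: prime_dvd_mult_iff)
  ultimately show ?thesis
    by (simp only: integral_atI not_False_eq_True)
qed

lemma integral_at_sum:
  assumes "prime p" "\<And>i. i \<in> A \<Longrightarrow> integral_at p (f i)"
  shows "integral_at p (\<Sum>i\<in>A. f i)"
  using assms by (induction A rule: infinite_finite_induct) (auto intro: integral_at_add)

text \<open>Turns the congruence into integrality of \<open>x / p\<close>, which is compatible with
  sums and with integral factors.\<close>

lemma rat_cong_0I:
  assumes "prime p" "integral_at p (x / of_nat p)"
  shows "rat_cong_0 x (int p)"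
proof -
  obtain u v where uv: "x / of_nat p = of_int u / of_int v" "\<not> int p dvd v"
    using assms(2) unfolding integral_at_def by blast
  obtain c d where cd: "quotient_of x = (c, d)" by fastforce
  have x: "x * of_int d = of_int c"
    using quotient_of_div[OF cd] quotient_of_denom_pos[OF cd] by simp
  have "v \<noteq> 0"
    using uv(2) by auto
  then have "x * of_int v = of_int u * of_nat p"
    using uv(1) prime_gt_0_nat[OF assms(1)] by (simp add: divide_eq_eq eq_divide_eq)
  then have "of_int (c * v) = (of_int (int p * u * d) :: rat)"
    by (simp flip: x add: mult_ac)
  then have "c * v = int p * u * d"
    by (simp only: of_int_eq_iff)
  then have "int p dvd c * v" by simp
  then show ?thesis
    using uv(2) assms(1) by (simp add: prime_dvd_mult_iff rat_cong_0_def cd)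
qed

text \<open>Modulo the \<open>p\<close>-part of \<open>k!\<close>, the fraction is congruent to some natural number \<open>w\<close>, and
  \<open>k!\<close> divides \<open>w (w - 1) \<dots> (w - k + 1)\<close>.\<close>

lemma integral_at_gbinomial:
  assumes "prime p" "integral_at p s"
  shows "integral_at p (s gchoose k)"
proof -
  obtain u v where s: "s = of_int u / of_int v" and v: "\<not> int p dvd v"
    using assms(2) unfolding integral_at_def by blast
  have "v \<noteq> 0" using v by auto
  define P where "P = int p"
  have P: "prime P" using assms(1) by (simp add: P_def)
  obtain m where m: "fact k = P ^ multiplicity P (fact k) * m" "\<not> P dvd m"
    using P by (metis fact_nonzero multiplicity_decompose' not_prime_unit)
  define q where "q = P ^ multiplicity P (fact k)"
  have fact: "fact k = q * m"
    unfolding q_def by (rule m(1))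
  have "q > 0" using prime_gt_0_int[OF P] by (simp add: q_def)
  have "coprime v q"
    using P v unfolding q_def P_def
    by (metis coprime_commute coprime_power_left_iff prime_imp_coprime)
  then obtain x where x: "[v * x = 1] (mod q)"
    using cong_solve_coprime_int by blast
  define w where "w = nat (x * u mod q)"
  have w: "[v * int w = u] (mod q)"
  proof -
    have "[v * int w = v * (x * u)] (mod q)"
      using \<open>q > 0\<close> by (intro cong_mult cong_refl) (simp add: w_def)
    also have "[v * (x * u) = u] (mod q)"
      using cong_scalar_right[OF x, of u] by (simp add: mult.assoc)
    finally show ?thesis .
  qed
  \<comment> \<open>\<open>C\<close> is \<open>v ^ k * fact k * (s gchoose k)\<close>. Once
    \<open>q\<close> divides it, only \<open>v ^ k * m\<close>, which is prime to \<open>p\<close>,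
    is left as denominator.\<close>
  define C where "C = (\<Prod>i=0..<k. u - int i * v)"
  have fall: "(\<Prod>i=0..<k. int w - int i) = fact k * int (w choose k)"
  proof -
    have "(of_int (\<Prod>i=0..<k. int w - int i) :: rat) = of_int (fact k * int (w choose k))"
      using gbinomial_mult_fact[of k "of_nat w :: rat"] by (simp add: binomial_gbinomial)
    then show ?thesis by (simp only: of_int_eq_iff)
  qed
  have "[C = (\<Prod>i=0..<k. v * int w - int i * v)] (mod q)"
    unfolding C_def by (intro cong_prod cong_diff cong_refl cong_sym[OF w])
  also have "(\<Prod>i=0..<k. v * int w - int i * v) = v ^ k * (\<Prod>i=0..<k. int w - int i)"
    by (induction k) (simp_all add: algebra_simps)
  also have "\<dots> = q * (v ^ k * m * int (w choose k))"
    unfolding fall fact by simp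
  also have "[\<dots> = 0] (mod q)"
    by (simp add: cong_0_iff)
  finally obtain c where c: "C = q * c"
    by (auto simp: cong_0_iff)
  have "fact k * (s gchoose k) = (\<Prod>i=0..<k. s - of_nat i)"
    by (rule gbinomial_mult_fact)
  also have "\<dots> = (\<Prod>i=0..<k. of_int (u - int i * v) / of_int v)"
    using \<open>v \<noteq> 0\<close> by (intro prod.cong refl) (simp add: s field_simps)
  also have "\<dots> = of_int C / of_int (v ^ k)"
    by (simp add: C_def prod_dividef)
  also have "fact k = (of_int (q * m) :: rat)"
    unfolding fact[symmetric] by simp
  finally have "of_int (q * m) * (s gchoose k) = of_int (q * c) / of_int (v ^ k)"
    unfolding c .
  moreover have "m \<noteq> 0" using m by auto
  ultimately have "s gchoose k = of_int c / of_int (v ^ k * m)"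
    using \<open>q > 0\<close> \<open>v \<noteq> 0\<close> by (simp add: field_simps)
  moreover have "\<not> int p dvd v ^ k * m"
    using m(2) v P prime_dvd_power[of "int p" v k] unfolding P_def
    by (auto simp: prime_dvd_mult_iff)
  ultimately show ?thesis
    by (simp only: integral_atI not_False_eq_True)
qed

definition fps_integral_at :: "nat \<Rightarrow> rat fps \<Rightarrow> bool"
  where "fps_integral_at p f \<longleftrightarrow> (\<forall>n. integral_at p (fps_nth f n))"

lemma fps_integral_at_mult:
  "prime p \<Longrightarrow> fps_integral_at p f \<Longrightarrow> fps_integral_at p g \<Longrightarrow> fps_integral_at p (f * g)"
  by (auto simp: fps_integral_at_def fps_mult_nth intro!: integral_at_sum integral_at_mult)

lemma fps_integral_at_diff:
  assumes "prime p" "fps_integral_at p f" "fps_integral_at p g"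
  shows "fps_integral_at p (f - g)"
proof -
  have "integral_at p (fps_nth f n + of_int (- 1) * fps_nth g n)" for n
    using assms unfolding fps_integral_at_def
    by (intro integral_at_add integral_at_mult integral_at_of_int) auto
  then show ?thesis
    by (simp add: fps_integral_at_def)
qed

lemma fps_integral_at_1: "prime p \<Longrightarrow> fps_integral_at p 1"
  by (simp add: fps_integral_at_def)

lemma fps_integral_at_X_power: "prime p \<Longrightarrow> fps_integral_at p (fps_X ^ n)"
  by (simp add: fps_integral_at_def fps_X_power_nth)

lemma fps_integral_at_power:
  "prime p \<Longrightarrow> fps_integral_at p f \<Longrightarrow> fps_integral_at p (f ^ n)"
  by (induction n) (auto intro: fps_integral_at_mult fps_integral_at_1)

lemma fps_integral_at_prod:
  assumes "prime p" "\<And>i. i \<in> A \<Longrightarrow> fps_integral_at p (f i)"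
  shows "fps_integral_at p (\<Prod>i\<in>A. f i)"
  using assms
  by (induction A rule: infinite_finite_induct) (auto intro: fps_integral_at_mult fps_integral_at_1)

text \<open>Each coefficient is a finite sum of generalized binomials of \<open>s\<close> times
  coefficients of powers of \<open>f - 1\<close>.\<close>

lemma fps_integral_at_rpow:
  assumes "prime p" "integral_at p s" "fps_integral_at p f"
  shows "fps_integral_at p (fps_rpow f s)"
proof -
  have "fps_integral_at p ((f - 1) ^ i)" for i
    by (intro fps_integral_at_power fps_integral_at_diff fps_integral_at_1 assms)
  then show ?thesis
    unfolding fps_integral_at_def fps_rpow_def fps_compose_nth fps_binomial_nth
    using assms(1,2) by (blast intro: integral_at_sum integral_at_mult integral_at_gbinomial)
qed

text \<open>Compare coefficients in \<open>(f\<^sup>p)' = p f' f\<^bsup>p-1\<^esup>\<close>.\<close>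

lemma integral_at_fps_power_prime_nth:
  assumes "prime p" "fps_integral_at p f" "\<not> p dvd n"
  shows "integral_at p (fps_nth (f ^ p) n / of_nat p)"
proof -
  obtain m where n: "n = Suc m"
    using assms(3) by (cases n) auto
  have p: "(of_nat p :: rat) \<noteq> 0" using assms(1) by auto
  let ?D = "fps_nth (fps_deriv f * f ^ (p - 1)) m"
  have "fps_deriv (f ^ p) = fps_const (of_nat p) * (fps_deriv f * f ^ (p - 1))"
    by (simp add: fps_deriv_power mult.assoc)
  then have "of_nat n * fps_nth (f ^ p) n = of_nat p * ?D"
    using n by (metis fps_deriv_nth fps_mult_left_const_nth Suc_eq_plus1)
  \<comment> \<open>The factor \<open>1 / n\<close> is integral at \<open>p\<close>, because
    \<open>p\<close> does not divide \<open>n\<close>.\<close>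
  then have eq: "fps_nth (f ^ p) n / of_nat p = ?D * (of_int 1 / of_int (int n))"
    using p n by (simp add: field_simps)
  have "fps_integral_at p (fps_deriv f)"
    using assms unfolding fps_integral_at_def fps_deriv_nth
    by (metis integral_at_mult integral_at_of_int of_int_of_nat_eq)
  then have "integral_at p ?D"
    using fps_integral_at_mult fps_integral_at_power assms
    unfolding fps_integral_at_def by blast
  then show ?thesis
    unfolding eq using assms by (intro integral_at_mult integral_atI) auto
qed

lemma fps_rpow_add:
  assumes "fps_nth f 0 = 1"
  shows "fps_rpow f (s + t) = fps_rpow f s * fps_rpow f t"
  using assms by (simp add: fps_rpow_def fps_binomial_add_mult fps_compose_mult_distrib)

lemma fps_rpow_of_nat_mult:
  assumes "fps_nth f 0 = 1"
  shows "fps_rpow f (of_nat n * s) = fps_rpow f s ^ n"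
proof (induction n)
  case 0
  then show ?case using fps_rpow_of_nat[OF assms, of 0] by simp
next
  case (Suc n)
  then show ?case by (simp add: distrib_right fps_rpow_add[OF assms])
qed

section \<open>The form x^2 + 3y^2 modulo p\<close>

text \<open>With exponent \<open>p\<close> in place of \<open>p - 1\<close>, multiples of
  \<open>p\<close> are covered too, which spares later case distinctions.\<close>

lemma fermat_int:
  assumes "prime p"
  shows "[u ^ p = u] (mod int p)"
proof -
  define a where "a = nat (u mod int p)"
  have a: "[u = int a] (mod int p)"
    using prime_gt_0_nat[OF assms] by (simp add: a_def cong_def)
  have "[a ^ p = a] (mod p)"
  proof (cases "p dvd a")
    case True
    then show ?thesis
      using prime_gt_0_nat[OF assms] by (metis cong_0_iff cong_sym cong_trans dvd_power dvd_trans)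
  next
    case False
    then have "[a * a ^ (p - 1) = a * 1] (mod p)"
      using fermat_theorem[OF assms] by (intro cong_mult cong_refl)
    then show ?thesis
      using prime_gt_0_nat[OF assms] by (simp flip: power_Suc)
  qed
  then have "[int a ^ p = int a] (mod int p)"
    by (metis cong_int_iff of_nat_power)
  then show ?thesis
    using a by (meson cong_pow cong_sym cong_trans)
qed

text \<open>If \<open>p = 3 k + 2\<close>, then \<open>z \<mapsto> z\<^bsup>2 k + 1\<^esup>\<close> inverts cubing, as \<open>3 (2 k + 1) = p + (p - 1)\<close>.\<close>

lemma cong_cube_cancel:
  assumes "prime p" "p mod 3 = 2" "[u ^ 3 = v ^ 3] (mod int p)"
  shows "[u = v] (mod int p)"
proof -
  define k where "k = p div 3"
  have k: "p + (p - 1) = 3 * (2 * k + 1)"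
  proof -
    have "p = 3 * k + 2"
      using mult_div_mod_eq[of 3 p] assms(2) by (simp add: k_def)
    then show ?thesis by simp
  qed
  have inv: "[(z ^ 3) ^ (2 * k + 1) = z] (mod int p)" for z
  proof -
    have "(z ^ 3) ^ (2 * k + 1) = z ^ p * z ^ (p - 1)"
      by (simp only: k power_mult[symmetric] power_add[symmetric])
    also have "[\<dots> = z * z ^ (p - 1)] (mod int p)"
      by (intro cong_mult fermat_int assms cong_refl)
    also have "z * z ^ (p - 1) = z ^ p"
      using prime_gt_0_nat[OF assms(1)] by (simp flip: power_Suc)
    also have "[z ^ p = z] (mod int p)"
      by (rule fermat_int[OF assms(1)])
    finally show ?thesis .
  qed
  show ?thesis
    using inv[of u] inv[of v] cong_pow[OF assms(3), of "2 * k + 1"]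
    by (meson cong_sym cong_trans)
qed

text \<open>If \<open>x\<^sup>2 \<equiv> -3y\<^sup>2\<close>, then \<open>(x + y)\<^sup>3 \<equiv> (-2y)\<^sup>3\<close>, so \<open>x \<equiv> -3y\<close> and hence \<open>12y\<^sup>2 \<equiv> 0\<close>.\<close>

lemma dvd_of_dvd_norm_form:
  fixes x y :: int
  assumes "prime p" "odd p" "p mod 3 = 2" "int p dvd x\<^sup>2 + 3 * y\<^sup>2"
  shows "int p dvd x"
proof -
  have P: "prime (int p)" using assms(1) by simp
  have "(x + y) ^ 3 - (- 2 * y) ^ 3 = (x + 3 * y) * (x\<^sup>2 + 3 * y\<^sup>2)"
    by (simp add: algebra_simps power2_eq_square power3_eq_cube)
  then have "[(x + y) ^ 3 = (- 2 * y) ^ 3] (mod int p)"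
    using assms(4) by (simp add: cong_iff_dvd_diff)
  then have "[x + y = - 2 * y] (mod int p)"
    by (rule cong_cube_cancel[OF assms(1,3)])
  then have 1: "int p dvd x + 3 * y"
    by (simp add: cong_iff_dvd_diff algebra_simps)
  have "12 * y\<^sup>2 = (x\<^sup>2 + 3 * y\<^sup>2) - (x + 3 * y) * (x - 3 * y)"
    by (simp add: algebra_simps power2_eq_square)
  also have "int p dvd \<dots>"
    using 1 assms(4) by (intro dvd_diff dvd_mult2)
  finally have "int p dvd 2 * 2 * 3 * y\<^sup>2" by simp
  \<comment> \<open>Oddness excludes \<open>p = 2\<close> and the residue modulo 3 excludes
    \<open>p = 3\<close>, so 12 can be cancelled.\<close>
  moreover have "\<not> int p dvd 2"
  proof
    assume "int p dvd 2"
    then have "p dvd 2" by presburger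
    then show False
      using assms(1,2) by (metis primes_dvd_imp_eq two_is_prime_nat even_numeral)
  qed
  moreover have "\<not> int p dvd 3"
  proof
    assume "int p dvd 3"
    then have "p dvd 3" by presburger
    then have "p = 3"
      using assms(1) primes_dvd_imp_eq[of p 3] by simp
    then show False using assms(3) by simp
  qed
  ultimately have "int p dvd y"
    using P prime_dvd_power by (metis prime_dvd_mult_iff)
  then show ?thesis
    using 1 by (metis dvd_add_left_iff dvd_mult)
qed

section \<open>Coefficients of the product of cubes\<close>

lemma fps_nth_eq_of_X_power_dvd_diff:
  fixes f g :: "'a::comm_ring_1 fps"
  assumes "fps_X ^ n dvd f - g" "k < n"
  shows "fps_nth f k = fps_nth g k"
proof -
  obtain h where "f - g = fps_X ^ n * h"
    using assms(1) by blast
  then have "fps_nth (f - g) k = 0"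
    using assms(2) by (simp add: fps_X_power_mult_nth)
  then show ?thesis by simp
qed

text \<open>A monomial \<open>q\<^bsup>i(i+1)/2 + 3j(j+1)/2\<^esup>\<close> with exponent \<open>k\<close> satisfies
  \<open>(2i+1)\<^sup>2 + 3(2j+1)\<^sup>2 = 4 (2k+1)\<close>, and \<open>-3\<close> is not a square modulo \<open>p\<close>.\<close>

lemma integral_at_cube_product_nth:
  assumes "prime p" "odd p" "p mod 3 = 2" "p dvd 2 * k + 1" "k \<le> m"
  shows "integral_at p
    (fps_nth (q_fact fps_X m ^ 3 * q_fact (fps_X ^ 3) m ^ 3) k / of_nat p)"
proof -
  let ?c = "\<lambda>j. (-1) ^ j * int (2 * j + 1)"
  let ?t = "\<lambda>j::nat. j * (j + 1) div 2"
  define J :: "rat fps \<Rightarrow> rat fps" where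
    "J q = (\<Sum>j\<le>m. (-1) ^ j * of_nat (2 * j + 1) * q ^ ?t j)" for q
  have J: "q ^ Suc m dvd q_fact q m ^ 3 - J q" if "fps_nth q 0 = 0" for q
    unfolding J_def using that by (rule jacobi_cube_cong)
  have 1: "fps_X ^ Suc m dvd q_fact fps_X m ^ 3 - J fps_X"
    by (rule J) simp
  \<comment> \<open>For \<open>q = X^3\<close> the truncated identity is more precise than needed
    and is weakened to the precision of the first factor.\<close>
  have "(fps_X :: rat fps) ^ Suc m dvd (fps_X ^ 3) ^ Suc m"
    by (intro dvd_power_same) simp
  also have "(fps_X ^ 3) ^ Suc m dvd q_fact (fps_X ^ 3) m ^ 3 - J (fps_X ^ 3)"
    by (rule J) simp
  finally have 2: "fps_X ^ Suc m dvd q_fact (fps_X ^ 3) m ^ 3 - J (fps_X ^ 3)" .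
  have "fps_X ^ Suc m dvd q_fact fps_X m ^ 3 * q_fact (fps_X ^ 3) m ^ 3 - J fps_X * J (fps_X ^ 3)"
  proof -
    have "a * b - c * d = (a - c) * b + c * (b - d)" for a b c d :: "rat fps"
      by (simp add: algebra_simps)
    then show ?thesis
      using 1 2 by (metis dvd_add dvd_mult dvd_mult2)
  qed
  then have nth_eq: "fps_nth (q_fact fps_X m ^ 3 * q_fact (fps_X ^ 3) m ^ 3) k =
      fps_nth (J fps_X * J (fps_X ^ 3)) k"
    using assms(5) by (intro fps_nth_eq_of_X_power_dvd_diff[of "Suc m"]) auto
  have JJ: "J fps_X * J (fps_X ^ 3) =
      (\<Sum>i\<le>m. \<Sum>j\<le>m. fps_const (of_int (?c i * ?c j)) * fps_X ^ (?t i + 3 * ?t j))"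
  proof -
    have J_int: "J q = (\<Sum>j\<le>m. fps_const (of_int (?c j)) * q ^ ?t j)" for q
      unfolding J_def fps_of_int by simp
    show ?thesis
      unfolding J_int sum_product
      by (intro sum.cong refl) (simp add: power_add power_mult flip: fps_const_mult)
  qed
  have "fps_nth (q_fact fps_X m ^ 3 * q_fact (fps_X ^ 3) m ^ 3) k / (of_nat p :: rat) =
      (\<Sum>i\<le>m. \<Sum>j\<le>m. if k = ?t i + 3 * ?t j then of_int (?c i * ?c j) / of_nat p else 0)"
    unfolding nth_eq JJ fps_sum_nth sum_divide_distrib
    by (intro sum.cong refl) (simp add: fps_X_power_nth)
  then show ?thesis
  proof (rule ssubst, intro integral_at_sum assms(1))
    fix i j
    show "integral_at p (if k = ?t i + 3 * ?t j then of_int (?c i * ?c j) / of_nat p else 0)"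
    proof (cases "k = ?t i + 3 * ?t j")
      case True
      have tri: "2 * ?t j = j * (j + 1)" for j :: nat
        by simp
      have "4 * (2 * k + 1) = (2 * i + 1)\<^sup>2 + 3 * (2 * j + 1)\<^sup>2"
      proof -
        have "2 * k = i * (i + 1) + 3 * (j * (j + 1))"
          using True tri[of i] tri[of j] by linarith
        then show ?thesis by (simp add: power2_eq_square algebra_simps)
      qed
      then have "p dvd (2 * i + 1)\<^sup>2 + 3 * (2 * j + 1)\<^sup>2"
        using assms(4) by (metis dvd_mult)
      then have "int p dvd int ((2 * i + 1)\<^sup>2 + 3 * (2 * j + 1)\<^sup>2)"
        by (simp only: int_dvd_int_iff)
      then have "int p dvd (int (2 * i + 1))\<^sup>2 + 3 * (int (2 * j + 1))\<^sup>2"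
        by (simp only: of_nat_add of_nat_mult of_nat_power of_nat_numeral)
      \<comment> \<open>One divisible factor of the coefficient suffices, so nothing is claimed
        about \<open>2 * j + 1\<close>.\<close>
      then have "int p dvd int (2 * i + 1)"
        by (rule dvd_of_dvd_norm_form[OF assms(1-3)])
      then have "int p dvd ?c i * ?c j"
        by (intro dvd_mult2 dvd_mult)
      then obtain e where "?c i * ?c j = int p * e" ..
      then have "of_int (?c i * ?c j) / of_nat p = (of_int e :: rat)"
        using prime_gt_0_nat[OF assms(1)] by (simp only:) simp
      then show ?thesis
        using integral_at_of_int[OF assms(1)] unfolding if_P[OF True] by simp
    qed (simp add: assms(1))
  qed
qed

section \<open>Partial products and the congruence\<close>

lemma prod_eq_q_fact: "(\<Prod>j\<le>n. 1 - q ^ Suc j) = q_fact q (Suc n)"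
  by (induction n) (simp_all add: q_fact_Suc)

text \<open>By X-adic convergence each coefficient is eventually that of the partial products. The
  bound \<open>M \<ge> n\<close> keeps index \<open>n\<close> within the range of the truncated
  Jacobi identity.\<close>

lemma p_coeff_eq_partial_product:
  assumes "m > 0"
  obtains M where "M \<ge> n" "p_coeff m t n =
    fps_nth (\<Prod>j\<le>M. fps_rpow ((1 - fps_X ^ Suc j) * (1 - fps_X ^ (m * Suc j))) t) n"
proof -
  have "eventually (\<lambda>M. fps_nth (\<Prod>j\<le>M. fps_rpow ((1 - fps_X ^ Suc j) *
      (1 - fps_X ^ (m * Suc j))) t) n = fps_nth (p_gf m t) n) sequentially"
    using has_prod_imp_tendsto[OF p_gf_has_prod[OF assms]] unfolding tendsto_fps_iff by blast
  then have "eventually (\<lambda>M. M \<ge> n \<and> fps_nth (\<Prod>j\<le>M. fps_rpow ((1 - fps_X ^ Suc j) *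
      (1 - fps_X ^ (m * Suc j))) t) n = fps_nth (p_gf m t) n) sequentially"
    using eventually_ge_at_top by eventually_elim auto
  from eventually_happens'[OF sequentially_bot this] obtain M where "M \<ge> n"
    "fps_nth (\<Prod>j\<le>M. fps_rpow ((1 - fps_X ^ Suc j) * (1 - fps_X ^ (m * Suc j))) t) n =
      fps_nth (p_gf m t) n"
    by blast
  then show ?thesis
    using that[of M] by (simp only: p_coeff_def)
qed

theorem theorem1p13:
  fixes a b d :: int and l r :: nat
  assumes "b \<ge> 1" and "coprime a b"
    and "prime l" and "odd l" and "int l dvd a + d * b"
    and "r < l"
    and "d = 3"
    and "l mod 12 = 5 \<or> l mod 12 = 11"
    and "l dvd 2 * r + 1"
  shows "\<forall>n. rat_cong_0 (p_coeff 3 (- (of_int a / of_int b)) (l * n + r)) (int l)"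
proof
  fix n
  define N where "N = l * n + r"
  define t :: rat where "t = - (of_int a / of_int b)"
  have l: "l > 0" using prime_gt_0_nat[OF assms(3)] .
  have l_mod_3: "l mod 3 = 2"
  proof -
    have "l mod 3 = l mod 12 mod 3" by (simp add: mod_mod_cancel)
    then show ?thesis using assms(8) by auto
  qed
  obtain c where c: "a + 3 * b = int l * c"
    using assms(5,7) by auto
  \<comment> \<open>Chosen so that \<open>-a/b = 3 - (a + 3*b)/b = 3 + l * s\<close>.\<close>
  define s :: rat where "s = of_int (- c) / of_int b"
  have "(of_int (a + 3 * b) :: rat) = of_int (int l * c)"
    unfolding c ..
  then have t_eq: "t = of_nat 3 + of_nat l * s"
    using assms(1) by (simp add: t_def s_def field_simps)
  have "\<not> int l dvd b"
  proof
    assume "int l dvd b"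
    then have "int l dvd a"
      using assms(5) by (simp add: dvd_add_left_iff)
    then have "is_unit (int l)"
      by (rule coprime_common_divisor[OF assms(2) _ \<open>int l dvd b\<close>])
    then show False using assms(3) by auto
  qed
  then have s: "integral_at l s"
    unfolding s_def by (rule integral_atI)
  define g :: "nat \<Rightarrow> rat fps" where
    "g j = (1 - fps_X ^ Suc j) * (1 - fps_X ^ (3 * Suc j))" for j
  obtain M where M: "M \<ge> N" "p_coeff 3 t N = fps_nth (\<Prod>j\<le>M. fps_rpow (g j) t) N"
    using p_coeff_eq_partial_product[of 3 N t] unfolding g_def by auto
  define A :: "rat fps" where "A = q_fact fps_X (Suc M) ^ 3 * q_fact (fps_X ^ 3) (Suc M) ^ 3"
  define Q where "Q = (\<Prod>j\<le>M. fps_rpow (g j) s)"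
  have "fps_rpow (g j) t = g j ^ 3 * fps_rpow (g j) s ^ l" for j
  proof -
    have "fps_nth (g j) 0 = 1" by (simp add: g_def)
    then show ?thesis
      unfolding t_eq by (simp only: fps_rpow_add fps_rpow_of_nat fps_rpow_of_nat_mult)
  qed
  then have "(\<Prod>j\<le>M. fps_rpow (g j) t) = (\<Prod>j\<le>M. g j) ^ 3 * Q ^ l"
    by (simp add: Q_def prod.distrib prod_power_distrib)
  also have "(\<Prod>j\<le>M. g j) = q_fact fps_X (Suc M) * q_fact (fps_X ^ 3) (Suc M)"
    unfolding g_def prod.distrib power_mult prod_eq_q_fact ..
  finally have prod_eq: "(\<Prod>j\<le>M. fps_rpow (g j) t) = A * Q ^ l"
    by (simp add: A_def power_mult_distrib)
  have g_int: "fps_integral_at l (g j)" for j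
    unfolding g_def using assms(3)
    by (intro fps_integral_at_mult fps_integral_at_diff fps_integral_at_1 fps_integral_at_X_power)
  have Q_int: "fps_integral_at l Q"
    unfolding Q_def by (intro fps_integral_at_prod fps_integral_at_rpow g_int s assms(3))
  have A_int: "fps_integral_at l A"
    unfolding A_def q_fact_def power_mult[symmetric] using assms(3)
    by (intro fps_integral_at_mult fps_integral_at_power fps_integral_at_prod fps_integral_at_diff
        fps_integral_at_1 fps_integral_at_X_power)
  have "p_coeff 3 t N / of_nat l =
      (\<Sum>i=0..N. fps_nth A i * fps_nth (Q ^ l) (N - i) / of_nat l)"
    unfolding M(2) prod_eq fps_mult_nth sum_divide_distrib ..
  also have "integral_at l \<dots>"
  proof (intro integral_at_sum assms(3))
    fix i assume i: "i \<in> {0..N}"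
    \<comment> \<open>If \<open>l\<close> divides \<open>N - i\<close>, then
      \<open>2 * i + 1\<close> is congruent to \<open>2 * N + 1\<close>, hence to 0, and the
      coefficient of \<open>A\<close> supplies the factor \<open>l\<close>. Otherwise the
      coefficient of \<open>Q ^ l\<close> does.\<close>
    show "integral_at l (fps_nth A i * fps_nth (Q ^ l) (N - i) / of_nat l)"
    proof (cases "l dvd N - i")
      case True
      have "2 * N + 1 = l * (2 * n) + (2 * r + 1)"
        by (simp add: N_def algebra_simps)
      then have "l dvd 2 * N + 1"
        using assms(9) by (metis dvd_add dvd_triv_left)
      moreover have "2 * N + 1 = 2 * (N - i) + (2 * i + 1)"
        using i by simp
      ultimately have "l dvd 2 * i + 1"
        using True by (metis dvd_add_right_iff dvd_mult)
      then have "integral_at l (fps_nth A i / of_nat l)"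
        unfolding A_def using i M(1) by (intro integral_at_cube_product_nth assms l_mod_3) auto
      moreover have "integral_at l (fps_nth (Q ^ l) (N - i))"
        using fps_integral_at_power[OF assms(3) Q_int] by (simp add: fps_integral_at_def)
      ultimately show ?thesis
        using integral_at_mult[OF assms(3)] by fastforce
    next
      case False
      then have "integral_at l (fps_nth (Q ^ l) (N - i) / of_nat l)"
        by (rule integral_at_fps_power_prime_nth[OF assms(3) Q_int])
      moreover have "integral_at l (fps_nth A i)"
        using A_int by (simp add: fps_integral_at_def)
      ultimately show ?thesis
        using integral_at_mult[OF assms(3)] by fastforce
    qed
  qed
  finally show "rat_cong_0 (p_coeff 3 (- (of_int a / of_int b)) (l * n + r)) (int l)"
    unfolding N_def t_def by (rule rat_cong_0I[OF assms(3)])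
qed

end
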